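(* Let $G$ be a connected $(2K_2, C_3, C_5)$-free graph and let $S$ be any minimal vertex separator of $G$. Then: (i) $S$ is an independent set; (ii) if $G-S$ has a non-trivial component $G_1$, then for every vertex $x\in S$, $N_G(x)\cap V(G_1)$ is an independent set; (iii) for every edge $\{u,v\}$ of a non-trivial component $G_1$ of $G-S$, one endpoint, say $u$, is adjacent to every vertex of $S$ and the other endpoint $v$ satisfies $N_G(v)\cap S=\emptyset$; (iv) if $T$ is the set of all vertices of the trivial components of $G-S$, then the subgraph of $G$ induced on $T\cup S$ is a complete bipartite graph; (v) if $U$ and $U'$ denote the sets of vertices of a non-trivial component of $G-S$ that are, respectively, adjacent to every vertex of $S$ and not adjacent to every vertex of $S$, then there exists a vertex $u\in U$ adjacent to every vertex of $U'$.
   Context: All graphs are finite, simple, undirected. A graph is $(H_1,\dots,H_r)$-free if it contains none of $H_1,\dots,H_r$ as an induced subgraph; $2K_2$ is two disjoint edges, $C_n$ the $n$-cycle. A minimal vertex separator of a connected graph $G$ is a set $S\subseteq V(G)$ such that $G-S$ (the subgraph induced on $V(G)\setminus S$) is disconnected, and no proper subset of $S$ has this property. A component of $G-S$ is trivial if it has a single vertex, non-trivial otherwise. $N_G(u)$ is the neighbourhood of $u$. *)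

theory Defs
  imports "Graph_Theory.Graph_Theory"
begin

(* A finite simple undirected graph is a "graph": a finite symmetric digraph without loops or
   parallel arcs. An edge {u,v} is represented by the two arcs u -> v and v -> u. *)

definition two_K2 :: "(nat, nat \<times> nat) pre_digraph" where
  "two_K2 = with_proj \<lparr> pverts = {0, 1, 2, 3}, parcs = {(0,1), (1,0), (2,3), (3,2)} \<rparr>"

(* This is the n-cycle only for n >= 3: n = 1 gives a loop, n = 2 a single edge. *)
definition cycle_graph :: "nat \<Rightarrow> (nat, nat \<times> nat) pre_digraph" where
  "cycle_graph n = with_proj \<lparr> pverts = {..<n},
     parcs = {(i, j). i < n \<and> j < n \<and> (j = Suc i mod n \<or> i = Suc j mod n)} \<rparr>"

definition induced_free :: "('c, 'd) pre_digraph set \<Rightarrow> ('a, 'b) pre_digraph \<Rightarrow> bool" where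
  "induced_free Hs G \<longleftrightarrow> (\<forall>H \<in> Hs. \<not> (\<exists>K. induced_subgraph K G \<and> digraph_iso K H))"

definition delete_verts :: "('a, 'b) pre_digraph \<Rightarrow> 'a set \<Rightarrow> ('a, 'b) pre_digraph" where
  "delete_verts G S = G \<restriction> (verts G - S)"

(* Digraph_Component.connected is false for the null graph, which does not count as
   disconnected either; hence deleting all vertices never separates a graph. *)
definition disconnected :: "('a, 'b) pre_digraph \<Rightarrow> bool" where
  "disconnected G \<longleftrightarrow> verts G \<noteq> {} \<and> \<not> Digraph_Component.connected G"

definition vertex_separator :: "('a, 'b) pre_digraph \<Rightarrow> 'a set \<Rightarrow> bool" where
  "vertex_separator G S \<longleftrightarrow> S \<subseteq> verts G \<and> disconnected (delete_verts G S)"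

definition minimal_vertex_separator :: "('a, 'b) pre_digraph \<Rightarrow> 'a set \<Rightarrow> bool" where
  "minimal_vertex_separator G S \<longleftrightarrow>
     vertex_separator G S \<and> (\<forall>S'. S' \<subset> S \<longrightarrow> \<not> vertex_separator G S')"

(* The connected components of a symmetric digraph are its strongly connected components. *)
definition trivial_components :: "('a, 'b) pre_digraph \<Rightarrow> ('a, 'b) pre_digraph set" where
  "trivial_components G = {C \<in> pre_digraph.sccs G. card (verts C) = 1}"

definition nontrivial_components :: "('a, 'b) pre_digraph \<Rightarrow> ('a, 'b) pre_digraph set" where
  "nontrivial_components G = {C \<in> pre_digraph.sccs G. card (verts C) \<noteq> 1}"

definition neighbourhood :: "('a, 'b) pre_digraph \<Rightarrow> 'a \<Rightarrow> 'a set" where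
  "neighbourhood G u = {v. u \<rightarrow>\<^bsub>G\<^esub> v}"

definition independent_set :: "('a, 'b) pre_digraph \<Rightarrow> 'a set \<Rightarrow> bool" where
  "independent_set G A \<longleftrightarrow> A \<subseteq> verts G \<and> (\<forall>u \<in> A. \<forall>v \<in> A. \<not> u \<rightarrow>\<^bsub>G\<^esub> v)"

(* Both parts are required to be nonempty. *)
definition complete_bipartite :: "('a, 'b) pre_digraph \<Rightarrow> bool" where
  "complete_bipartite G \<longleftrightarrow> (\<exists>m \<ge> 1. \<exists>n \<ge> 1. complete_bipartite_digraph m n G)"

end

(* If some component of G - S has an edge, 2K2-freeness makes every other component a single
   vertex. By minimality each component sees all of S, so a trivial component {t} has t adjacent to
   every vertex of S, and triangle-freeness makes S independent. An edge u-v of G - S together with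
   the edge t-s forces s to see exactly one of u, v; if s and s' saw different ends, then
   t-s-u-v-s'-t would be a 5-cycle. Finally 2K2-freeness orders the neighbourhoods of the vertices
   of U in U' by inclusion, and a vertex of U with a largest neighbourhood sees all of U'. *)

theory Submission
  imports Defs
begin

section \<open>Induced subgraphs\<close>

lemma dominates_induce_subgraph_iff:
  "u \<rightarrow>\<^bsub>G \<restriction> X\<^esub> v \<longleftrightarrow> u \<in> X \<and> v \<in> X \<and> u \<rightarrow>\<^bsub>G\<^esub> v"
  by (auto simp: arcs_ends_conv)

lemma (in graph) graph_induce_subgraph:
  assumes "X \<subseteq> verts G"
  shows "graph (G \<restriction> X)"
proof -
  have ind: "induced_subgraph (G \<restriction> X) G"
    using assms by (rule induced_induce)
  interpret H: digraph "G \<restriction> X"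
    using ind by (rule digraphI_induced)
  show ?thesis
    using induced_graph_imp_symmetric[OF sym_arcs ind] by (rule H.graphI)
qed

text \<open>Working form of freeness: instead of an induced subgraph with an isomorphism, it asks
  for an injection \<open>f\<close> into \<open>verts G\<close> that preserves both adjacency and
  non-adjacency. The hypothesis on \<open>parcs P\<close> makes every arc of the pattern come from a
  pair of its vertices, hence from an arc of \<open>G\<close>.\<close>

lemma (in graph) induced_freeD:
  fixes P :: "'c pair_pre_digraph"
  assumes free: "induced_free Hs G" and "with_proj P \<in> Hs"
    and wf: "parcs P \<subseteq> pverts P \<times> pverts P"
    and inj: "inj_on f (pverts P)" and sub: "f ` pverts P \<subseteq> verts G"
    and adj: "\<And>i j. i \<in> pverts P \<Longrightarrow> j \<in> pverts P \<Longrightarrow> f i \<rightarrow>\<^bsub>G\<^esub> f j \<longleftrightarrow> (i, j) \<in> parcs P"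
  shows False
proof -
  define X where "X = f ` pverts P"
  define g where "g = the_inv_into (pverts P) f"
  \<comment> \<open>The arcs of \<open>with_proj P\<close> are pairs with \<open>fst\<close> as tail
    and \<open>snd\<close> as head, so an arc must be sent to the pair of the images of its
    ends.\<close>
  define h where "h = \<lparr>iso_verts = g, iso_arcs = (\<lambda>e. (g (tail G e), g (head G e))),
    iso_head = snd, iso_tail = fst\<rparr>"
  have gf: "g (f i) = i" if "i \<in> pverts P" for i
    using that inj by (simp add: g_def the_inv_into_f_f)
  have ginj: "inj_on g X"
    unfolding X_def by (auto intro!: inj_onI simp: gf)
  have arcs: "(\<lambda>e. (g (tail G e), g (head G e))) ` arcs (G \<restriction> X) = parcs P"
  proof (intro set_eqI iffI)
    fix p assume "p \<in> (\<lambda>e. (g (tail G e), g (head G e))) ` arcs (G \<restriction> X)"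
    then obtain e i j where "e \<in> arcs G" "i \<in> pverts P" "j \<in> pverts P" "tail G e = f i" "head G e = f j"
      "p = (g (tail G e), g (head G e))"
      by (auto simp: X_def)
    moreover from this have "f i \<rightarrow>\<^bsub>G\<^esub> f j"
      by (auto simp: arcs_ends_conv intro: rev_image_eqI)
    ultimately show "p \<in> parcs P"
      by (simp add: adj gf)
  next
    fix p assume p: "p \<in> parcs P"
    then obtain i j where ij: "p = (i, j)" "i \<in> pverts P" "j \<in> pverts P"
      using wf by blast
    then have "f i \<rightarrow>\<^bsub>G\<^esub> f j"
      using p adj by simp
    then obtain e where "e \<in> arcs G" "tail G e = f i" "head G e = f j"
      by blast
    then show "p \<in> (\<lambda>e. (g (tail G e), g (head G e))) ` arcs (G \<restriction> X)"
      using ij by (auto simp: X_def gf intro!: rev_image_eqI[of e])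
  qed
  have "pre_digraph.digraph_isomorphism (G \<restriction> X) h"
    unfolding pre_digraph.digraph_isomorphism_def
  proof (intro conjI)
    show "inj_on (iso_arcs h) (arcs (G \<restriction> X))"
    proof (rule inj_onI)
      fix a b assume ab: "a \<in> arcs (G \<restriction> X)" "b \<in> arcs (G \<restriction> X)" "iso_arcs h a = iso_arcs h b"
      \<comment> \<open>Without parallel arcs an arc is determined by its ends, so injectivity of
        \<open>g\<close> on \<open>X\<close> passes to arcs.\<close>
      then have "tail G a = tail G b" "head G a = head G b"
        using ginj by (auto simp: h_def inj_on_def)
      then show "a = b"
        using ab no_multi_arcs by (auto simp: arc_to_ends_def)
    qed
  qed (use ginj in \<open>auto simp: h_def\<close>)
  moreover have "with_proj P = app_iso h (G \<restriction> X)"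
  proof -
    have "g ` X = pverts P"
      by (force simp: X_def gf)
    then show ?thesis
      using arcs by (simp add: app_iso_def h_def with_proj_def)
  qed
  moreover have "induced_subgraph (G \<restriction> X) G"
    using sub unfolding X_def by (rule induced_induce)
  ultimately show False
    using assms(1,2) unfolding induced_free_def digraph_iso_def by metis
qed

text \<open>The neighbour is the first step of a walk from \<open>w\<close> to some second
  vertex.\<close>

lemma strongly_connected_neighbour:
  assumes "strongly_connected C" "card (verts C) \<noteq> 1" "w \<in> verts C"
  obtains x where "w \<rightarrow>\<^bsub>C\<^esub> x"
proof -
  have "verts C \<noteq> {w}"
    using assms(2) by auto
  then obtain w' where "w' \<in> verts C" "w' \<noteq> w"
    using assms(3) by blast
  then have "w \<rightarrow>\<^sup>*\<^bsub>C\<^esub> w'"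
    using assms by (auto simp: strongly_connected_def)
  then show thesis
    using \<open>w' \<noteq> w\<close> that by (cases rule: pre_digraph.converse_reachable_cases) auto
qed

section \<open>Forbidden subgraphs\<close>

locale two_K2_C3_C5_free_graph = graph G for G :: "('a, 'b) pre_digraph" +
  assumes free: "induced_free {two_K2, cycle_graph 3, cycle_graph 5} G"
begin

lemma not_dominates_self: "\<not> a \<rightarrow>\<^bsub>G\<^esub> a"
  using adj_not_same by blast

lemma dominates_commute: "a \<rightarrow>\<^bsub>G\<^esub> b \<longleftrightarrow> b \<rightarrow>\<^bsub>G\<^esub> a"
  using graph_symmetric by blast

lemma no_triangle:
  assumes "a \<rightarrow>\<^bsub>G\<^esub> b" "b \<rightarrow>\<^bsub>G\<^esub> c" "c \<rightarrow>\<^bsub>G\<^esub> a"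
  shows False
proof -
  have adj: "b \<rightarrow>\<^bsub>G\<^esub> a" "c \<rightarrow>\<^bsub>G\<^esub> b" "a \<rightarrow>\<^bsub>G\<^esub> c"
    using assms dominates_commute by blast+
  have dist: "distinct [a, b, c]"
    using assms not_dominates_self by auto
  have vs: "set [a, b, c] \<subseteq> verts G"
    using assms adj_in_verts by auto
  have lt3: "{..<3} = {0, 1, 2 :: nat}"
    by auto
  show False
  proof (rule induced_freeD[OF free])
    let ?P = "\<lparr>pverts = {..<3},
      parcs = {(i, j). i < 3 \<and> j < 3 \<and> (j = Suc i mod 3 \<or> i = Suc j mod 3)}\<rparr>"
    show "with_proj ?P \<in> {two_K2, cycle_graph 3, cycle_graph 5}"
      by (simp add: cycle_graph_def)
    \<comment> \<open>The embedding sends index \<open>i\<close> to the \<open>i\<close>-th entry of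
      the list; the later forbidden patterns are treated alike.\<close>
    show "inj_on ((!) [a, b, c]) (pverts ?P)"
      using dist by (intro inj_on_nth) auto
    show "(!) [a, b, c] ` pverts ?P \<subseteq> verts G"
      using vs by (simp add: lt3)
    show "[a, b, c] ! i \<rightarrow>\<^bsub>G\<^esub> [a, b, c] ! j \<longleftrightarrow> (i, j) \<in> parcs ?P"
      if "i \<in> pverts ?P" "j \<in> pverts ?P" for i j
    proof -
      have "i \<in> {0, 1, 2}" "j \<in> {0, 1, 2}"
        using that unfolding lt3[symmetric] by simp_all
      then show ?thesis
        by (elim insertE; simp add: assms adj not_dominates_self)
    qed
  qed auto
qed

lemma no_two_K2:
  assumes "a \<rightarrow>\<^bsub>G\<^esub> b" "c \<rightarrow>\<^bsub>G\<^esub> d"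
  shows "a \<rightarrow>\<^bsub>G\<^esub> c \<or> a \<rightarrow>\<^bsub>G\<^esub> d \<or> b \<rightarrow>\<^bsub>G\<^esub> c \<or> b \<rightarrow>\<^bsub>G\<^esub> d"
proof (rule ccontr)
  assume contr: "\<not> ?thesis"
  have adj: "b \<rightarrow>\<^bsub>G\<^esub> a" "d \<rightarrow>\<^bsub>G\<^esub> c" "\<not> c \<rightarrow>\<^bsub>G\<^esub> a" "\<not> d \<rightarrow>\<^bsub>G\<^esub> a" "\<not> c \<rightarrow>\<^bsub>G\<^esub> b" "\<not> d \<rightarrow>\<^bsub>G\<^esub> b"
    "\<not> a \<rightarrow>\<^bsub>G\<^esub> c" "\<not> a \<rightarrow>\<^bsub>G\<^esub> d" "\<not> b \<rightarrow>\<^bsub>G\<^esub> c" "\<not> b \<rightarrow>\<^bsub>G\<^esub> d"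
    using assms contr dominates_commute by blast+
  \<comment> \<open>Identifying an end of one edge with an end of the other would turn an edge into
    one of the excluded cross edges.\<close>
  have dist: "distinct [a, b, c, d]"
    using assms adj not_dominates_self by auto
  have vs: "set [a, b, c, d] \<subseteq> verts G"
    using assms adj_in_verts by auto
  show False
  proof (rule induced_freeD[OF free])
    let ?P = "\<lparr>pverts = {0, 1, 2, 3 :: nat}, parcs = {(0,1), (1,0), (2,3), (3,2)}\<rparr>"
    show "with_proj ?P \<in> {two_K2, cycle_graph 3, cycle_graph 5}"
      by (simp add: two_K2_def)
    show "inj_on ((!) [a, b, c, d]) (pverts ?P)"
      using dist by (intro inj_on_nth) auto
    show "(!) [a, b, c, d] ` pverts ?P \<subseteq> verts G"
      using vs by simp
    show "[a, b, c, d] ! i \<rightarrow>\<^bsub>G\<^esub> [a, b, c, d] ! j \<longleftrightarrow> (i, j) \<in> parcs ?P"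
      if "i \<in> pverts ?P" "j \<in> pverts ?P" for i j
    proof -
      have "i \<in> {0, 1, 2, 3}" "j \<in> {0, 1, 2, 3}"
        using that by simp_all
      then show ?thesis
        by (elim insertE; simp add: assms adj not_dominates_self)
    qed
  qed simp
qed

text \<open>In a triangle-free graph a closed walk of length 5 is automatically an induced 5-cycle.
  Hence distinctness of the vertices never has to be checked when this is applied.\<close>

lemma no_closed_5_walk:
  assumes "a \<rightarrow>\<^bsub>G\<^esub> b" "b \<rightarrow>\<^bsub>G\<^esub> c" "c \<rightarrow>\<^bsub>G\<^esub> d" "d \<rightarrow>\<^bsub>G\<^esub> e" "e \<rightarrow>\<^bsub>G\<^esub> a"
  shows False
proof -
  have adj: "b \<rightarrow>\<^bsub>G\<^esub> a" "c \<rightarrow>\<^bsub>G\<^esub> b" "d \<rightarrow>\<^bsub>G\<^esub> c" "e \<rightarrow>\<^bsub>G\<^esub> d" "a \<rightarrow>\<^bsub>G\<^esub> e"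
    using assms dominates_commute by blast+
  \<comment> \<open>Each chord closes a triangle with two consecutive edges of the walk.\<close>
  have chords: "\<not> a \<rightarrow>\<^bsub>G\<^esub> c" "\<not> c \<rightarrow>\<^bsub>G\<^esub> a" "\<not> b \<rightarrow>\<^bsub>G\<^esub> d" "\<not> d \<rightarrow>\<^bsub>G\<^esub> b" "\<not> c \<rightarrow>\<^bsub>G\<^esub> e" "\<not> e \<rightarrow>\<^bsub>G\<^esub> c"
    "\<not> d \<rightarrow>\<^bsub>G\<^esub> a" "\<not> a \<rightarrow>\<^bsub>G\<^esub> d" "\<not> e \<rightarrow>\<^bsub>G\<^esub> b" "\<not> b \<rightarrow>\<^bsub>G\<^esub> e"
    using assms adj no_triangle by blast+
  \<comment> \<open>A coincidence would turn an edge of the walk into a chord: with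
    \<open>a = c\<close>, the edge from \<open>c\<close> to \<open>d\<close> becomes the chord from
    \<open>a\<close> to \<open>d\<close>.\<close>
  have dist: "distinct [a, b, c, d, e]"
    using assms adj chords not_dominates_self by auto
  have vs: "set [a, b, c, d, e] \<subseteq> verts G"
    using assms adj_in_verts by auto
  have lt5: "{..<5} = {0, 1, 2, 3, 4 :: nat}"
    by auto
  show False
  proof (rule induced_freeD[OF free])
    let ?P = "\<lparr>pverts = {..<5},
      parcs = {(i, j). i < 5 \<and> j < 5 \<and> (j = Suc i mod 5 \<or> i = Suc j mod 5)}\<rparr>"
    show "with_proj ?P \<in> {two_K2, cycle_graph 3, cycle_graph 5}"
      by (simp add: cycle_graph_def)
    show "inj_on ((!) [a, b, c, d, e]) (pverts ?P)"
      using dist by (intro inj_on_nth) auto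
    show "(!) [a, b, c, d, e] ` pverts ?P \<subseteq> verts G"
      using vs by (simp add: lt5)
    show "[a, b, c, d, e] ! i \<rightarrow>\<^bsub>G\<^esub> [a, b, c, d, e] ! j \<longleftrightarrow> (i, j) \<in> parcs ?P"
      if "i \<in> pverts ?P" "j \<in> pverts ?P" for i j
    proof -
      have "i \<in> {0, 1, 2, 3, 4}" "j \<in> {0, 1, 2, 3, 4}"
        using that unfolding lt5[symmetric] by simp_all
      then show ?thesis
        by (elim insertE; simp add: assms adj chords not_dominates_self)
    qed
  qed auto
qed

end

section \<open>Components of the complement of a minimal separator\<close>

locale free_graph_minimal_separator = two_K2_C3_C5_free_graph +
  fixes S :: "'a set"
  assumes conn: "Digraph_Component.connected G"
    and minsep: "minimal_vertex_separator G S"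
begin

abbreviation H :: "('a, 'b) pre_digraph" where
  "H \<equiv> delete_verts G S"

section \<open>Components of G - S and their contact with the separator\<close>

lemma separator_subset: "S \<subseteq> verts G"
  using minsep by (simp add: minimal_vertex_separator_def vertex_separator_def)

sublocale H: graph H
  unfolding delete_verts_def by (rule graph_induce_subgraph) blast

lemma dominates_H_iff: "u \<rightarrow>\<^bsub>H\<^esub> v \<longleftrightarrow> u \<in> verts G - S \<and> v \<in> verts G - S \<and> u \<rightarrow>\<^bsub>G\<^esub> v"
  by (simp add: delete_verts_def dominates_induce_subgraph_iff)

lemma verts_H: "verts H = verts G - S"
  by (simp add: delete_verts_def)

lemma component_verts: "C \<in> H.sccs \<Longrightarrow> verts C \<subseteq> verts G - S"
  unfolding verts_H[symmetric] by (blast dest: H.in_sccs_imp_induced)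

lemma component_dominates: "C \<in> H.sccs \<Longrightarrow> u \<rightarrow>\<^bsub>C\<^esub> v \<Longrightarrow> u \<in> verts C \<and> v \<in> verts C \<and> u \<rightarrow>\<^bsub>G\<^esub> v"
  by (metis H.in_sccs_imp_induced H.adj_mono dominates_H_iff induced_imp_subgraph subgraph_def
      wf_digraph.adj_in_verts)

text \<open>The edge survives in \<open>H\<close>, and by symmetry its ends reach each other there,
  so they share a strongly connected component. Thus a component can be left only through
  \<open>S\<close>.\<close>

lemma component_closed:
  assumes C: "C \<in> H.sccs" and uv: "u \<in> verts C" "u \<rightarrow>\<^bsub>G\<^esub> v" "v \<notin> S"
  shows "v \<in> verts C"
proof -
  have "u \<rightarrow>\<^bsub>H\<^esub> v"
    using component_verts[OF C] uv adj_in_verts by (auto simp: dominates_H_iff)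
  then have "u \<rightarrow>\<^sup>*\<^bsub>H\<^esub> v" "v \<rightarrow>\<^sup>*\<^bsub>H\<^esub> u"
    by (auto dest: H.graph_symmetric)
  moreover have "verts C \<in> H.sccs_verts"
    using C by (simp add: H.sccs_verts_conv)
  ultimately show ?thesis
    using uv(1) by (auto simp: H.in_sccs_verts_conv_reachable)
qed

text \<open>By minimality, putting \<open>s\<close> back into G - S yields a connected graph. A walk
  from \<open>C\<close> to \<open>s\<close> in it can leave \<open>C\<close> only by stepping onto
  \<open>s\<close>.\<close>

lemma component_adjacent_separator:
  assumes C: "C \<in> H.sccs" and s: "s \<in> S"
  obtains c where "c \<in> verts C" "c \<rightarrow>\<^bsub>G\<^esub> s"
proof (rule ccontr)
  assume contr: "\<not> thesis"
  let ?K = "delete_verts G (S - {s})"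
  interpret K: graph ?K
    unfolding delete_verts_def by (rule graph_induce_subgraph) blast
  have vK: "verts ?K = verts G - (S - {s})"
    by (simp add: delete_verts_def)
  have "S - {s} \<subset> S"
    using s by blast
  then have "\<not> vertex_separator G (S - {s})"
    using minsep by (simp add: minimal_vertex_separator_def)
  \<comment> \<open>This rules out the null graph, so that not being \<open>disconnected\<close>
    really means being connected.\<close>
  moreover have "s \<in> verts ?K"
    using s separator_subset vK by blast
  ultimately have "Digraph_Component.connected ?K"
    using separator_subset by (auto simp: vertex_separator_def disconnected_def)
  then have sc: "strongly_connected ?K"
    using K.symmetric_connected_imp_strongly_connected K.sym_arcs by blast
  obtain c where c: "c \<in> verts C"
    using C by (auto simp: H.sccs_def strongly_connected_def)
  have "c \<rightarrow>\<^sup>*\<^bsub>?K\<^esub> s"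
    using sc \<open>s \<in> verts ?K\<close> c component_verts[OF C] by (auto simp: strongly_connected_def vK)
  \<comment> \<open>If no vertex of \<open>C\<close> sees \<open>s\<close>, everything reachable
    from \<open>c\<close> in \<open>?K\<close> stays inside \<open>C\<close>; applied to
    \<open>s\<close> itself this is absurd.\<close>
  then have "s \<in> verts C"
  proof (induction rule: K.reachable_induct)
    case base
    show ?case by (rule c)
  next
    case (step u v)
    have uv: "u \<rightarrow>\<^bsub>G\<^esub> v" "v \<notin> S - {s}"
      using step by (auto simp: delete_verts_def dominates_induce_subgraph_iff)
    moreover have "v \<noteq> s"
      using contr that step uv by blast
    ultimately show ?case
      using component_closed[OF C] step by blast
  qed
  then show False
    using component_verts[OF C] s by blast
qed

text \<open>Deleting nothing leaves the connected graph \<open>G\<close>. This later keeps one side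
  of the bipartite graph nonempty and makes a vertex without neighbours in \<open>S\<close> fail to
  see all of \<open>S\<close>.\<close>

lemma separator_nonempty: "S \<noteq> {}"
proof
  assume "S = {}"
  then have "H = G"
    using induce_eq_iff_induced[OF induced_subgraph_refl] by (simp add: delete_verts_def)
  then show False
    using minsep conn
    by (simp add: minimal_vertex_separator_def vertex_separator_def disconnected_def)
qed

lemma trivial_component_adjacent:
  assumes "C \<in> trivial_components H" "t \<in> verts C" "s \<in> S"
  shows "t \<rightarrow>\<^bsub>G\<^esub> s"
proof -
  have C: "C \<in> H.sccs" "verts C = {t}"
    using assms(1,2) by (auto simp: trivial_components_def card_1_singleton_iff)
  then show ?thesis
    using component_adjacent_separator[OF C(1) assms(3)] by auto
qed

section \<open>At most one non-trivial component, at least one trivial one\<close>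

lemma nontrivial_component_neighbour:
  assumes "C \<in> nontrivial_components H" "w \<in> verts C"
  obtains x where "x \<in> verts C" "w \<rightarrow>\<^bsub>G\<^esub> x"
proof -
  have C: "C \<in> H.sccs" "card (verts C) \<noteq> 1"
    using assms(1) by (auto simp: nontrivial_components_def)
  then have "strongly_connected C"
    by blast
  then obtain x where "w \<rightarrow>\<^bsub>C\<^esub> x"
    using C(2) assms(2) by (rule strongly_connected_neighbour)
  then show thesis
    using component_dominates[OF C(1)] that by blast
qed

text \<open>One edge from each of two such components would form an induced 2K2, since no edge joins
  different components.\<close>

lemma nontrivial_components_unique:
  assumes C: "C \<in> nontrivial_components H" and D: "D \<in> nontrivial_components H"
  shows "C = D"
proof (rule ccontr)
  assume ne: "C \<noteq> D"
  have sccs: "C \<in> H.sccs" "D \<in> H.sccs"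
    using C D by (auto simp: nontrivial_components_def)
  then obtain a c where ac: "a \<in> verts C" "c \<in> verts D"
    by (auto simp: H.sccs_def strongly_connected_def)
  obtain b where b: "b \<in> verts C" "a \<rightarrow>\<^bsub>G\<^esub> b"
    using C ac(1) by (rule nontrivial_component_neighbour)
  obtain d where d: "d \<in> verts D" "c \<rightarrow>\<^bsub>G\<^esub> d"
    using D ac(2) by (rule nontrivial_component_neighbour)
  have "\<not> x \<rightarrow>\<^bsub>G\<^esub> y" if "x \<in> verts C" "y \<in> verts D" for x y
    using that component_closed[OF sccs(1)] component_verts[OF sccs(2)] H.scc_disj[OF sccs ne]
    by blast
  then show False
    using no_two_K2[OF b(2) d(2)] ac b(1) d(1) by blast
qed

text \<open>Otherwise all components are non-trivial, hence by uniqueness there is only one, and G -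
  S is connected.\<close>

lemma ex_trivial_component: "trivial_components H \<noteq> {}"
proof
  assume "trivial_components H = {}"
  then have nontriv: "H.sccs = nontrivial_components H"
    by (auto simp: trivial_components_def nontrivial_components_def)
  have disc: "disconnected H"
    using minsep by (simp add: minimal_vertex_separator_def vertex_separator_def)
  then obtain C where "C \<in> H.sccs"
    using H.exists_scc by (auto simp: disconnected_def)
  then have sccs: "H.sccs = {C}"
    using nontriv nontrivial_components_unique by blast
  have "u \<rightarrow>\<^sup>*\<^bsub>H\<^esub> v" if "u \<in> verts H" "v \<in> verts H" for u v
  proof -
    have "u \<in> verts C" "v \<in> verts C"
      using that[THEN H.scc_for_vert_ex] unfolding sccs by simp_all
    moreover have "strongly_connected C"
      using \<open>C \<in> H.sccs\<close> by blast
    ultimately have "u \<rightarrow>\<^sup>*\<^bsub>C\<^esub> v"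
      by (simp add: strongly_connected_def)
    then show ?thesis
      using H.in_sccs_imp_induced[OF \<open>C \<in> H.sccs\<close>, THEN induced_imp_subgraph]
      by (rule H.reachable_mono)
  qed
  then have "Digraph_Component.connected H"
    using disc by (intro H.connectedI H.reachable_mk_symmetricI) (auto simp: disconnected_def)
  then show False
    using disc by (simp add: disconnected_def)
qed

lemma ex_vertex_adjacent_separator:
  obtains t C where "C \<in> trivial_components H" "verts C = {t}" "\<forall>s \<in> S. t \<rightarrow>\<^bsub>G\<^esub> s"
proof -
  obtain C t where "C \<in> trivial_components H" "verts C = {t}"
    using ex_trivial_component by (auto simp: trivial_components_def card_1_singleton_iff)
  then show thesis
    using trivial_component_adjacent that by blast
qed

section \<open>Structure of the separator and the components\<close>

lemma separator_independent: "independent_set G S"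
  using ex_vertex_adjacent_separator no_triangle dominates_commute separator_subset
  unfolding independent_set_def by metis

lemma neighbourhood_independent: "independent_set G (neighbourhood G x \<inter> A)"
  using no_triangle dominates_commute adj_in_verts
  unfolding independent_set_def neighbourhood_def by blast

lemma nontrivial_component_edge:
  assumes C: "C \<in> nontrivial_components H" and uv: "u \<in> verts C" "v \<in> verts C" "u \<rightarrow>\<^bsub>G\<^esub> v"
  shows "((\<forall>s \<in> S. u \<rightarrow>\<^bsub>G\<^esub> s) \<and> neighbourhood G v \<inter> S = {}) \<or>
    ((\<forall>s \<in> S. v \<rightarrow>\<^bsub>G\<^esub> s) \<and> neighbourhood G u \<inter> S = {})"
proof -
  have C': "C \<in> H.sccs"
    using C by (simp add: nontrivial_components_def)
  obtain t D where D: "D \<in> trivial_components H" "verts D = {t}" and "\<forall>s \<in> S. t \<rightarrow>\<^bsub>G\<^esub> s"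
    by (rule ex_vertex_adjacent_separator)
  then have t: "t \<rightarrow>\<^bsub>G\<^esub> s" if "s \<in> S" for s
    using that by blast
  have "D \<in> H.sccs" "D \<noteq> C"
    using C D by (auto simp: trivial_components_def nontrivial_components_def)
  \<comment> \<open>Being outside both \<open>C\<close> and \<open>S\<close>, the vertex
    \<open>t\<close> is adjacent to neither \<open>u\<close> nor \<open>v\<close>.\<close>
  then have "t \<notin> verts C" "t \<notin> S"
    using H.scc_disj[OF _ C'] D(2) component_verts by blast+
  then have tuv: "\<not> u \<rightarrow>\<^bsub>G\<^esub> t" "\<not> v \<rightarrow>\<^bsub>G\<^esub> t"
    using component_closed[OF C'] uv by blast+
  \<comment> \<open>The edges u-v and t-s need a cross edge, which must end in \<open>s\<close>;
    having both would be a triangle.\<close>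
  have one: "u \<rightarrow>\<^bsub>G\<^esub> s \<longleftrightarrow> \<not> v \<rightarrow>\<^bsub>G\<^esub> s" if "s \<in> S" for s
    using no_two_K2[OF uv(3) t[OF that]] no_triangle[of u v s] uv(3) tuv dominates_commute by blast
  \<comment> \<open>If only one of \<open>s\<close>, \<open>s'\<close> sees \<open>u\<close>, then
    by \<open>one\<close> the other sees \<open>v\<close>, and the walk closes up through
    \<open>t\<close>. The two instances treat the two directions.\<close>
  have same: "u \<rightarrow>\<^bsub>G\<^esub> s \<longleftrightarrow> u \<rightarrow>\<^bsub>G\<^esub> s'" if "s \<in> S" "s' \<in> S" for s s'
    using no_closed_5_walk[of t s u v s'] no_closed_5_walk[of t s' u v s] one[OF that(1)]
      one[OF that(2)] t[OF that(1)] t[OF that(2)] uv(3) dominates_commute by blast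
  show ?thesis
    using one same unfolding neighbourhood_def by blast
qed

lemma trivial_components_complete_bipartite:
  defines "T \<equiv> \<Union>C \<in> trivial_components H. verts C"
  shows "complete_bipartite (G \<restriction> (T \<union> S))"
proof -
  have T_sub: "T \<subseteq> verts G - S"
    unfolding T_def trivial_components_def using component_verts by blast
  have T_S: "t \<rightarrow>\<^bsub>G\<^esub> s" if "t \<in> T" "s \<in> S" for t s
    using that trivial_component_adjacent unfolding T_def by blast
  \<comment> \<open>An edge inside \<open>T\<close> would have both ends in a single one-vertex
    component and so be a loop.\<close>
  have T_T: "\<not> t \<rightarrow>\<^bsub>G\<^esub> t'" if "t \<in> T" "t' \<in> T" for t t'
  proof
    assume tt': "t \<rightarrow>\<^bsub>G\<^esub> t'"
    obtain C where "C \<in> trivial_components H" "t \<in> verts C"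
      using \<open>t \<in> T\<close> unfolding T_def by blast
    then have C: "C \<in> H.sccs" "verts C = {t}"
      by (auto simp: trivial_components_def card_1_singleton_iff)
    have "t' \<in> verts C"
      using component_closed[OF C(1) _ tt'] C(2) that(2) T_sub by auto
    then show False
      using C(2) tt' not_dominates_self by simp
  qed
  have "T \<noteq> {}"
  proof -
    obtain C t where "C \<in> trivial_components H" "verts C = {t}"
      by (rule ex_vertex_adjacent_separator)
    then show ?thesis
      unfolding T_def by blast
  qed
  moreover have "finite T" "finite S"
    using T_sub separator_subset finite_verts by (blast intro: finite_subset)+
  ultimately have "card T \<ge> 1" "card S \<ge> 1"
    using separator_nonempty by (simp_all add: Suc_le_eq card_gt_0_iff)
  moreover have "complete_bipartite_digraph (card T) (card S) (G \<restriction> (T \<union> S))"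
    unfolding complete_bipartite_digraph_def
  proof (intro conjI exI)
    show "graph (G \<restriction> (T \<union> S))"
      using T_sub separator_subset by (intro graph_induce_subgraph) blast
    have "u \<rightarrow>\<^bsub>G \<restriction> (T \<union> S)\<^esub> v \<longleftrightarrow> (u, v) \<in> T \<times> S \<union> S \<times> T" for u v
    proof -
      have "\<not> s \<rightarrow>\<^bsub>G\<^esub> s'" if "s \<in> S" "s' \<in> S" for s s'
        using separator_independent that by (simp add: independent_set_def)
      then show ?thesis
        using T_S T_T dominates_commute[of u v] unfolding dominates_induce_subgraph_iff by blast
    qed
    \<comment> \<open>This equation fixes \<open>T\<close> and \<open>S\<close> as the two parts of
      the bipartition.\<close>
    then show "arcs_ends (G \<restriction> (T \<union> S)) = T \<times> S \<union> S \<times> T"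
      by (auto simp: set_eq_iff)
  qed (use T_sub in auto)
  ultimately show ?thesis
    unfolding complete_bipartite_def by blast
qed

lemma nontrivial_component_dominating_vertex:
  assumes C: "C \<in> nontrivial_components H"
  defines "U \<equiv> {w \<in> verts C. \<forall>s \<in> S. w \<rightarrow>\<^bsub>G\<^esub> s}"
    and "U' \<equiv> {w \<in> verts C. \<not> (\<forall>s \<in> S. w \<rightarrow>\<^bsub>G\<^esub> s)}"
  shows "\<exists>u \<in> U. \<forall>w \<in> U'. u \<rightarrow>\<^bsub>G\<^esub> w"
proof -
  have C': "C \<in> H.sccs"
    using C by (simp add: nontrivial_components_def)
  \<comment> \<open>The end with no neighbour in \<open>S\<close> lies in \<open>U'\<close> because
    \<open>S\<close> is nonempty. With \<open>disj\<close> this makes the component bipartite with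
    parts \<open>U\<close> and \<open>U'\<close>.\<close>
  have split: "u \<in> U \<and> v \<in> U' \<or> v \<in> U \<and> u \<in> U'" if "u \<in> verts C" "v \<in> verts C" "u \<rightarrow>\<^bsub>G\<^esub> v" for u v
    using nontrivial_component_edge[OF C that] separator_nonempty that
    unfolding U_def U'_def neighbourhood_def by blast
  have disj: "U \<inter> U' = {}"
    unfolding U_def U'_def by blast
  have UC: "U \<subseteq> verts C" "U' \<subseteq> verts C"
    unfolding U_def U'_def by blast+
  have fin: "finite (verts C)"
    using component_verts[OF C'] finite_verts by (blast intro: finite_subset)
  define N where "N u = {w \<in> U'. u \<rightarrow>\<^bsub>G\<^esub> w}" for u
  have finN: "finite (N u)" for u
    using fin UC by (auto simp: N_def intro: finite_subset)
  \<comment> \<open>Private neighbours \<open>c\<close> of \<open>a\<close> and \<open>d\<close> of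
    \<open>b\<close> would give edges a-c and b-d with no cross edge: a-b and c-d would lie inside
    one part.\<close>
  have nested: "N a \<subseteq> N b \<or> N b \<subseteq> N a" if ab: "a \<in> U" "b \<in> U" for a b
  proof (rule ccontr)
    assume "\<not> ?thesis"
    then obtain c d where cd: "c \<in> U'" "a \<rightarrow>\<^bsub>G\<^esub> c" "\<not> b \<rightarrow>\<^bsub>G\<^esub> c" "d \<in> U'" "b \<rightarrow>\<^bsub>G\<^esub> d" "\<not> a \<rightarrow>\<^bsub>G\<^esub> d"
      unfolding N_def by blast
    moreover have "\<not> a \<rightarrow>\<^bsub>G\<^esub> b" "\<not> c \<rightarrow>\<^bsub>G\<^esub> d"
      using split disj ab cd UC by blast+
    ultimately show False
      using no_two_K2[OF cd(2,5)] dominates_commute by blast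
  qed
  have "U \<noteq> {}"
  proof -
    obtain a where a: "a \<in> verts C"
      using C' by (auto simp: H.sccs_def strongly_connected_def)
    obtain b where "b \<in> verts C" "a \<rightarrow>\<^bsub>G\<^esub> b"
      using C a by (rule nontrivial_component_neighbour)
    then show ?thesis
      using split a by blast
  qed
  moreover have "finite U"
    using fin UC by (blast intro: finite_subset)
  ultimately obtain u where u: "u \<in> U" and max: "\<And>v. v \<in> U \<Longrightarrow> card (N v) \<le> card (N u)"
    using obtains_MAX[of U "\<lambda>u. card (N u)"] by (metis Max_ge finite_imageI imageI)
  have "u \<rightarrow>\<^bsub>G\<^esub> w" if w: "w \<in> U'" for w
  proof -
    \<comment> \<open>Any neighbour of \<open>w\<close> in the component lies in \<open>U\<close>,
      so \<open>w\<close> belongs to some \<open>N v\<close>, and it remains to see that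
      \<open>N u\<close> contains it.\<close>
    obtain v where v: "v \<in> verts C" "w \<rightarrow>\<^bsub>G\<^esub> v"
      using C subsetD[OF UC(2) w] by (rule nontrivial_component_neighbour)
    then have "v \<in> U" "w \<in> N v"
      using split disj w UC dominates_commute unfolding N_def by blast+
    \<comment> \<open>In the other case of \<open>nested\<close>, \<open>N u\<close> is contained in
      \<open>N v\<close> and is at least as large, so the two finite sets coincide.\<close>
    moreover have "N v \<subseteq> N u"
      using nested[OF u \<open>v \<in> U\<close>] max[OF \<open>v \<in> U\<close>] card_seteq[OF finN] by blast
    ultimately show ?thesis
      unfolding N_def by blast
  qed
  then show ?thesis
    using u by blast
qed

end

theorem theorem6:
  fixes G :: "('a, 'b) pre_digraph" and S :: "'a set"
  assumes "graph G"
    and "Digraph_Component.connected G"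
    and "induced_free {two_K2, cycle_graph 3, cycle_graph 5} G"
    and "minimal_vertex_separator G S"
  shows
    "independent_set G S \<and>
     (\<forall>G1 \<in> nontrivial_components (delete_verts G S). \<forall>x \<in> S.
        independent_set G (neighbourhood G x \<inter> verts G1)) \<and>
     (\<forall>G1 \<in> nontrivial_components (delete_verts G S). \<forall>u v. u \<rightarrow>\<^bsub>G1\<^esub> v \<longrightarrow>
        ((\<forall>s \<in> S. u \<rightarrow>\<^bsub>G\<^esub> s) \<and> neighbourhood G v \<inter> S = {}) \<or>
        ((\<forall>s \<in> S. v \<rightarrow>\<^bsub>G\<^esub> s) \<and> neighbourhood G u \<inter> S = {})) \<and>
     (\<forall>T. T = (\<Union>C \<in> trivial_components (delete_verts G S). verts C) \<longrightarrow>
        complete_bipartite (G \<restriction> (T \<union> S))) \<and>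
     (\<forall>G1 \<in> nontrivial_components (delete_verts G S). \<forall>U U'.
        U = {w \<in> verts G1. \<forall>s \<in> S. w \<rightarrow>\<^bsub>G\<^esub> s} \<longrightarrow>
        U' = {w \<in> verts G1. \<not> (\<forall>s \<in> S. w \<rightarrow>\<^bsub>G\<^esub> s)} \<longrightarrow>
        (\<exists>u \<in> U. \<forall>w \<in> U'. u \<rightarrow>\<^bsub>G\<^esub> w))"
proof -
  interpret free_graph_minimal_separator G S
    using assms
    by (simp add: free_graph_minimal_separator_def two_K2_C3_C5_free_graph_def
        two_K2_C3_C5_free_graph_axioms_def free_graph_minimal_separator_axioms_def)
  \<comment> \<open>The claim on edges speaks of arcs of \<open>G1\<close>, whereas
    \<open>nontrivial_component_edge\<close> expects arcs of \<open>G\<close> with both ends in the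
    component.\<close>
  have edge: "u \<in> verts G1" "v \<in> verts G1" "u \<rightarrow>\<^bsub>G\<^esub> v"
    if "G1 \<in> nontrivial_components (delete_verts G S)" "u \<rightarrow>\<^bsub>G1\<^esub> v" for G1 u v
    using that component_dominates unfolding nontrivial_components_def by blast+
  show ?thesis
  proof (intro conjI ballI allI impI)
    fix G1 u v
    assume "G1 \<in> nontrivial_components (delete_verts G S)" "u \<rightarrow>\<^bsub>G1\<^esub> v"
    then show "((\<forall>s \<in> S. u \<rightarrow>\<^bsub>G\<^esub> s) \<and> neighbourhood G v \<inter> S = {}) \<or>
        ((\<forall>s \<in> S. v \<rightarrow>\<^bsub>G\<^esub> s) \<and> neighbourhood G u \<inter> S = {})"
      by (intro nontrivial_component_edge edge)
  qed (simp_all only: separator_independent neighbourhood_independent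
      trivial_components_complete_bipartite nontrivial_component_dominating_vertex)
qed

end
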